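(* Let $U$ be a real $n\times m$ matrix and let $1/m\leqslant\lambda\leqslant\eta<1$. Then there exists $\sigma\subset\{1,\dots,m\}$ with $|\sigma|=k\geqslant\lambda m$ such that $$\|U_\sigma\|\leqslant\frac{1}{\sqrt{1-\lambda}}\left(\sqrt{\lambda+\eta}\,\|U\|+\sqrt{1+\frac{\lambda}{\eta}}\,\frac{\|U\|_{\mathrm{HS}}}{\sqrt m}\right).$$ In particular, for every $\lambda$ with $1/m\leqslant\lambda<1$ there exists $\sigma\subset\{1,\dots,m\}$ with $|\sigma|\geqslant\lambda m$ such that $$\|U_\sigma\|\leqslant\frac{\sqrt2}{\sqrt{1-\lambda}}\left(\sqrt\lambda\,\|U\|+\frac{\|U\|_{\mathrm{HS}}}{\sqrt m}\right).$$
   Context: $\|A\|$ is the operator norm of a matrix $A$ with respect to Euclidean norms, and $\|A\|_{\mathrm{HS}}=\sqrt{\mathrm{Tr}(AA^* )}$ is the Hilbert-Schmidt norm. $U_\sigma$ denotes the selection of the columns of $U$ with indices in $\sigma$ (an $n\times|\sigma|$ matrix). *)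

theory Defs
  imports Complex_Main "Jordan_Normal_Form.Matrix" "Jordan_Normal_Form.DL_Submatrix"
begin

definition vec_norm2 :: "real vec \<Rightarrow> real" where
  "vec_norm2 v = sqrt (v \<bullet> v)"

definition op_norm :: "real mat \<Rightarrow> real" where
  "op_norm A = Sup {vec_norm2 (A *\<^sub>v x) | x. x \<in> carrier_vec (dim_col A) \<and> vec_norm2 x \<le> 1}"

definition mat_trace :: "real mat \<Rightarrow> real" where
  "mat_trace A = (\<Sum>i<dim_row A. A $$ (i, i))"

text \<open>The matrices are real, so the adjoint is the transpose.\<close>

definition hs_norm :: "real mat \<Rightarrow> real" where
  "hs_norm A = sqrt (mat_trace (A * A\<^sup>T))"

text \<open>Columns are indexed from \<open>0\<close>. For \<open>S \<subseteq> {..<dim_col A}\<close> the result is the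
  \<open>dim_row A \<times> card S\<close> matrix of the columns of \<open>A\<close> with index in \<open>S\<close>, in increasing order.\<close>

definition select_cols :: "real mat \<Rightarrow> nat set \<Rightarrow> real mat" where
  "select_cols A S = submatrix A UNIV S"

lemma select_cols_carrier:
  assumes "A \<in> carrier_mat n m" "S \<subseteq> {..<m}"
  shows "select_cols A S \<in> carrier_mat n (card S)"
proof -
  have "{j. j < m \<and> j \<in> S} = S" using assms(2) by auto
  then show ?thesis
    using assms(1) by (auto simp: select_cols_def submatrix_def)
qed

lemma vec_norm2_nonneg: "0 \<le> vec_norm2 v"
  by (simp add: vec_norm2_def scalar_prod_def sum_nonneg)

lemma abs_component_le_vec_norm2:
  assumes "i < dim_vec v"
  shows "\<bar>v $ i\<bar> \<le> vec_norm2 v"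
proof -
  have "(v $ i)\<^sup>2 \<le> (\<Sum>j\<in>{0..<dim_vec v}. (v $ j)\<^sup>2)"
    using assms by (intro member_le_sum) auto
  then have "sqrt ((v $ i)\<^sup>2) \<le> vec_norm2 v"
    unfolding vec_norm2_def scalar_prod_def power2_eq_square by (rule real_sqrt_le_mono)
  then show ?thesis by simp
qed

text \<open>The set in the definition of \<open>op_norm\<close> is bounded and nonempty, so the supremum is
  a genuine one.\<close>

lemma op_norm_bdd_above:
  "bdd_above {vec_norm2 (A *\<^sub>v x) | x. x \<in> carrier_vec (dim_col A) \<and> vec_norm2 x \<le> 1}"
proof -
  let ?r = "\<lambda>i. \<Sum>j\<in>{0..<dim_col A}. \<bar>A $$ (i, j)\<bar>"
  have "vec_norm2 (A *\<^sub>v x) \<le> sqrt (\<Sum>i\<in>{0..<dim_row A}. ?r i * ?r i)"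
    if x: "x \<in> carrier_vec (dim_col A)" "vec_norm2 x \<le> 1" for x
  proof -
    have c: "\<bar>x $ j\<bar> \<le> 1" if "j < dim_col A" for j
      using abs_component_le_vec_norm2[of j x] x that by auto
    have r: "\<bar>(A *\<^sub>v x) $ i\<bar> \<le> ?r i" if i: "i < dim_row A" for i
    proof -
      have "(A *\<^sub>v x) $ i = (\<Sum>j\<in>{0..<dim_col A}. A $$ (i, j) * x $ j)"
        using i x by (simp add: scalar_prod_def)
      also have "\<bar>\<dots>\<bar> \<le> (\<Sum>j\<in>{0..<dim_col A}. \<bar>A $$ (i, j) * x $ j\<bar>)"
        by (rule sum_abs)
      also have "\<dots> \<le> ?r i"
        using c by (intro sum_mono) (auto simp: abs_mult intro: mult_left_le)
      finally show ?thesis .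
    qed
    have "(A *\<^sub>v x) $ i * (A *\<^sub>v x) $ i \<le> ?r i * ?r i" if "i < dim_row A" for i
      using mult_mono[OF r[OF that] r[OF that]] by (simp add: sum_nonneg)
    then show ?thesis
      unfolding vec_norm2_def scalar_prod_def
      by (intro real_sqrt_le_mono) (auto intro!: sum_mono)
  qed
  then show ?thesis by (intro bdd_aboveI) blast
qed

lemma op_norm_nonempty:
  "{vec_norm2 (A *\<^sub>v x) | x. x \<in> carrier_vec (dim_col A) \<and> vec_norm2 x \<le> 1} \<noteq> {}"
proof -
  have "vec_norm2 (0\<^sub>v (dim_col A)) \<le> 1" by (simp add: vec_norm2_def)
  then show ?thesis by fastforce
qed

end

theory Submission
  imports Defs "Jordan_Normal_Form.Determinant" "HOL-Analysis.L2_Norm"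
begin

text \<open>The columns are selected one at a time by the barrier method of Batson, Spielman and
  Srivastava. With \<open>u\<^sub>i\<close> the columns of \<open>U\<close> and \<open>A = (\<Sum>i\<in>\<sigma>. u\<^sub>i u\<^sub>i\<^sup>T)\<close>, one keeps \<open>A < b\<close>
  and does not let the potential \<open>\<Sum>i<m. u\<^sub>i \<bullet> (b - A)\<^sup>-\<^sup>1 u\<^sub>i\<close> grow. Raising the barrier \<open>b\<close> by \<open>\<delta>\<close>
  lowers the potential by at least \<open>\<delta> (\<Sum>i<m. |w\<^sub>i|\<^sup>2)\<close>, where \<open>w\<^sub>i = (b + \<delta> - A)\<^sup>-\<^sup>1 u\<^sub>i\<close>; by
  Sherman--Morrison, adding the column \<open>u\<^sub>i\<close> raises it by \<open>|U\<^sup>T w\<^sub>i|\<^sup>2 / (1 - u\<^sub>i \<bullet> w\<^sub>i)\<close>. As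
  \<open>|U\<^sup>T w| \<le> \<parallel>U\<parallel> |w|\<close>, averaging over the unselected columns shows that some column is
  affordable while \<open>\<parallel>U\<parallel>\<^sub>H\<^sub>S\<^sup>2 / b\<^sub>0 + \<parallel>U\<parallel>\<^sup>2 / \<delta>\<close> is less than their number, which at each of the
  \<open>k = \<lceil>\<lambda>m\<rceil>\<close> steps is greater than \<open>(1 - \<lambda>) m\<close>. Optimizing \<open>b\<^sub>0\<close> and \<open>\<delta>\<close> gives
  \<open>\<parallel>U\<^sub>\<sigma>\<parallel> \<le> (\<parallel>U\<parallel>\<^sub>H\<^sub>S + sqrt k \<parallel>U\<parallel>) / sqrt ((1 - \<lambda>) m)\<close>, and \<open>k \<le> \<lambda>m + 1 \<le> (\<lambda> + \<eta>) m\<close>.\<close>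

section \<open>Positive definite matrices and their inverses\<close>

lemma scalar_prod_self_nonneg: "0 \<le> v \<bullet> (v :: real vec)"
  by (simp add: scalar_prod_def sum_nonneg)

lemma scalar_prod_self_eq_0:
  fixes v :: "real vec"
  assumes "v \<in> carrier_vec n" "v \<bullet> v = 0"
  shows "v = 0\<^sub>v n"
  using assms by (intro eq_vecI) (auto simp: scalar_prod_def sum_nonneg_eq_0_iff)

lemma symmetric_scalar_prod:
  fixes M :: "real mat"
  assumes "M \<in> carrier_mat n n" "M\<^sup>T = M" "x \<in> carrier_vec n" "y \<in> carrier_vec n"
  shows "x \<bullet> (M *\<^sub>v y) = y \<bullet> (M *\<^sub>v x)"
proof -
  have "x \<bullet> (M *\<^sub>v y) = (M *\<^sub>v x) \<bullet> y"
    using transpose_vec_mult_scalar[of M n n y x] assms by simp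
  also have "\<dots> = y \<bullet> (M *\<^sub>v x)"
    using assms by (intro comm_scalar_prod[of _ n]) auto
  finally show ?thesis .
qed

definition pos_def :: "nat \<Rightarrow> real mat \<Rightarrow> bool" where
  "pos_def n M \<longleftrightarrow> M \<in> carrier_mat n n \<and> M\<^sup>T = M \<and>
     (\<forall>x\<in>carrier_vec n. x \<noteq> 0\<^sub>v n \<longrightarrow> 0 < x \<bullet> (M *\<^sub>v x))"

lemma pos_def_nonneg:
  assumes "pos_def n M" "x \<in> carrier_vec n"
  shows "0 \<le> x \<bullet> (M *\<^sub>v x)"
  using assms by (cases "x = 0\<^sub>v n") (auto simp: pos_def_def less_imp_le)

text \<open>A relation instead of an inverse operation: the barrier invariant carries the pair
  \<open>M\<close>, \<open>N\<close>, and with it the positivity of \<open>M\<close> and the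
  symmetry of both matrices.\<close>

definition pos_def_inverse :: "nat \<Rightarrow> real mat \<Rightarrow> real mat \<Rightarrow> bool" where
  "pos_def_inverse n M N \<longleftrightarrow> pos_def n M \<and> N \<in> carrier_mat n n \<and> N\<^sup>T = N \<and> M * N = 1\<^sub>m n \<and> N * M = 1\<^sub>m n"

text \<open>A kernel vector would violate definiteness, so \<open>det M\<close> is nonzero. The
  inverse is symmetric because \<open>N\<^sup>T\<close> is a right inverse of the symmetric
  \<open>M\<close> as well, and the two must agree.\<close>

lemma pos_def_inverse_exists:
  assumes "pos_def n M"
  shows "\<exists>N. pos_def_inverse n M N"
proof -
  have M: "M \<in> carrier_mat n n" and sym: "M\<^sup>T = M" using assms by (auto simp: pos_def_def)
  have "det M \<noteq> 0"
  proof
    assume "det M = 0"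
    then obtain v where "v \<in> carrier_vec n" "v \<noteq> 0\<^sub>v n" "M *\<^sub>v v = 0\<^sub>v n"
      using det_0_iff_vec_prod_zero_field[OF M] by blast
    then show False using assms by (force simp: pos_def_def)
  qed
  from det_non_zero_imp_unit[OF M this, of "()"]
  obtain N where N: "N \<in> carrier_mat n n" "N * M = 1\<^sub>m n"
    unfolding Units_def ring_mat_def by auto
  have MN: "M * N = 1\<^sub>m n" by (rule mat_mult_left_right_inverse[OF N(1) M N(2)])
  have "M * N\<^sup>T = (N * M)\<^sup>T" using transpose_mult[OF N(1) M] sym by simp
  also have "\<dots> = 1\<^sub>m n" by (simp add: N(2))
  finally have *: "M * N\<^sup>T = 1\<^sub>m n" .
  have "N\<^sup>T = N * M * N\<^sup>T" using N by simp
  also have "\<dots> = N * (M * N\<^sup>T)" using N(1) M by (intro assoc_mult_mat) auto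
  also have "\<dots> = N" using * N by simp
  finally show ?thesis
    using assms N MN by (auto simp: pos_def_inverse_def)
qed

context
  fixes n :: nat and M N :: "real mat"
  assumes inv: "pos_def_inverse n M N"
begin

lemma pos_def_inverse_carrier: "M \<in> carrier_mat n n" "N \<in> carrier_mat n n"
  using inv by (auto simp: pos_def_inverse_def pos_def_def)

lemma pos_def_inverse_cancel:
  assumes "v \<in> carrier_vec n"
  shows "M *\<^sub>v (N *\<^sub>v v) = v" "N *\<^sub>v (M *\<^sub>v v) = v"
  using inv assms pos_def_inverse_carrier
  by (auto simp: pos_def_inverse_def simp flip: assoc_mult_mat_vec)

lemma pos_def_inverse_sym:
  assumes "x \<in> carrier_vec n" "y \<in> carrier_vec n"
  shows "x \<bullet> (N *\<^sub>v y) = y \<bullet> (N *\<^sub>v x)" "x \<bullet> (M *\<^sub>v y) = y \<bullet> (M *\<^sub>v x)"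
  using inv assms by (auto simp: pos_def_inverse_def pos_def_def intro!: symmetric_scalar_prod[of _ n])

text \<open>With \<open>v = M *\<^sub>v (N *\<^sub>v v)\<close>, the form of \<open>N\<close> at
  \<open>v\<close> becomes the form of \<open>M\<close> at \<open>N *\<^sub>v v\<close>.\<close>

lemma pos_def_inverse_nonneg:
  assumes v: "v \<in> carrier_vec n"
  shows "0 \<le> v \<bullet> (N *\<^sub>v v)"
proof -
  note [simp] = pos_def_inverse_carrier
  have Nv: "N *\<^sub>v v \<in> carrier_vec n" using v by (intro mult_mat_vec_carrier[of _ n n]) auto
  have "0 \<le> (N *\<^sub>v v) \<bullet> (M *\<^sub>v (N *\<^sub>v v))"
    using inv Nv by (intro pos_def_nonneg[of n]) (auto simp: pos_def_inverse_def)
  also have "\<dots> = v \<bullet> (N *\<^sub>v v)"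
    using v Nv by (simp add: pos_def_inverse_cancel comm_scalar_prod[of v n])
  finally show ?thesis .
qed

end

section \<open>Response of the resolvent to a shift and to a rank-one downdate\<close>

lemma shift_mult_vec:
  fixes M :: "real mat"
  assumes "M \<in> carrier_mat n n" "x \<in> carrier_vec n"
  shows "(M + d \<cdot>\<^sub>m 1\<^sub>m n) *\<^sub>v x = M *\<^sub>v x + d \<cdot>\<^sub>v x"
  using assms by (intro eq_vecI) (auto simp: add_scalar_prod_distrib[of _ n])

text \<open>Put \<open>w = N' *\<^sub>v v\<close>, so that
  \<open>v = M *\<^sub>v w + d \<cdot>\<^sub>v w\<close>. Applying \<open>N\<close> and pairing with
  \<open>v\<close> yields three terms: the new form \<open>v \<bullet> w\<close>, the gain
  \<open>d * (w \<bullet> w)\<close>, and a term of second order in \<open>d\<close> that is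
  nonnegative and is dropped.\<close>

lemma resolvent_shift:
  assumes inv: "pos_def_inverse n M N" and d: "0 \<le> d"
  shows "\<exists>N'. pos_def_inverse n (M + d \<cdot>\<^sub>m 1\<^sub>m n) N' \<and>
    (\<forall>v\<in>carrier_vec n. d * ((N' *\<^sub>v v) \<bullet> (N' *\<^sub>v v)) \<le> v \<bullet> (N *\<^sub>v v) - v \<bullet> (N' *\<^sub>v v))"
proof -
  let ?M = "M + d \<cdot>\<^sub>m 1\<^sub>m n"
  note carr = pos_def_inverse_carrier[OF inv]
  have pd: "pos_def n ?M"
    unfolding pos_def_def
  proof (intro conjI ballI impI)
    show "?M \<in> carrier_mat n n" using carr by auto
    show "?M\<^sup>T = ?M"
    proof -
      have "M $$ (j, i) = M $$ (i, j)" if "i < n" "j < n" for i j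
        using inv index_transpose_mat(1)[of i M j] carr that
        by (auto simp: pos_def_inverse_def pos_def_def)
      then show ?thesis using carr by (intro eq_matI) auto
    qed
    fix x :: "real vec" assume x: "x \<in> carrier_vec n" "x \<noteq> 0\<^sub>v n"
    have "0 < x \<bullet> (M *\<^sub>v x)" using inv x by (auto simp: pos_def_inverse_def pos_def_def)
    also have "\<dots> \<le> x \<bullet> (M *\<^sub>v x) + d * (x \<bullet> x)"
      using d by (simp add: scalar_prod_self_nonneg)
    also have "\<dots> = x \<bullet> (?M *\<^sub>v x)"
      using x carr by (simp add: shift_mult_vec scalar_prod_add_distrib[of _ n])
    finally show "0 < x \<bullet> (?M *\<^sub>v x)" .
  qed
  then obtain N' where N': "pos_def_inverse n ?M N'" using pos_def_inverse_exists by blast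
  note carr' = pos_def_inverse_carrier[OF N']
  have "d * ((N' *\<^sub>v v) \<bullet> (N' *\<^sub>v v)) \<le> v \<bullet> (N *\<^sub>v v) - v \<bullet> (N' *\<^sub>v v)"
    if v: "v \<in> carrier_vec n" for v
  proof -
    define w where "w = N' *\<^sub>v v"
    have w: "w \<in> carrier_vec n" unfolding w_def using carr' v by auto
    have Nw: "N *\<^sub>v w \<in> carrier_vec n" using carr w by auto
    have veq: "v = M *\<^sub>v w + d \<cdot>\<^sub>v w"
      using pos_def_inverse_cancel(1)[OF N' v] shift_mult_vec[OF carr(1) w, of d] by (simp add: w_def)
    have Nv: "N *\<^sub>v v = w + d \<cdot>\<^sub>v (N *\<^sub>v w)"
      unfolding veq using carr w
      by (simp add: mult_add_distrib_mat_vec[of _ n n] mult_mat_vec[of _ n n] pos_def_inverse_cancel[OF inv])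
    have "v \<bullet> (N *\<^sub>v v) = v \<bullet> w + d * (v \<bullet> (N *\<^sub>v w))"
      unfolding Nv using v w Nw by (simp add: scalar_prod_add_distrib[of _ n])
    also have "v \<bullet> (N *\<^sub>v w) = w \<bullet> (N *\<^sub>v v)" by (rule pos_def_inverse_sym[OF inv v w])
    also have "\<dots> = w \<bullet> w + d * (w \<bullet> (N *\<^sub>v w))"
      unfolding Nv using v w Nw by (simp add: scalar_prod_add_distrib[of _ n])
    finally have "v \<bullet> (N *\<^sub>v v) = v \<bullet> w + d * (w \<bullet> w) + d * d * (w \<bullet> (N *\<^sub>v w))"
      by (simp add: algebra_simps)
    moreover have "0 \<le> d * d * (w \<bullet> (N *\<^sub>v w))"
      using pos_def_inverse_nonneg[OF inv w] by simp
    ultimately show ?thesis by (simp add: w_def)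
  qed
  with N' show ?thesis by blast
qed

definition outer :: "real vec \<Rightarrow> real mat" where
  "outer u = mat (dim_vec u) (dim_vec u) (\<lambda>(i, j). u $ i * u $ j)"

lemma outer_carrier [simp]: "u \<in> carrier_vec n \<Longrightarrow> outer u \<in> carrier_mat n n"
  by (auto simp: outer_def)

lemma downdate_mult_vec:
  fixes M :: "real mat"
  assumes "M \<in> carrier_mat n n" "x \<in> carrier_vec n" "u \<in> carrier_vec n"
  shows "(M - outer u) *\<^sub>v x = M *\<^sub>v x - (u \<bullet> x) \<cdot>\<^sub>v u"
proof -
  have "outer u *\<^sub>v x = (u \<bullet> x) \<cdot>\<^sub>v u"
    using assms
    by (intro eq_vecI) (auto simp: outer_def scalar_prod_def sum_distrib_left mult_ac intro!: sum.cong)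
  then show ?thesis using assms minus_mult_distrib_mat_vec[of M n n "outer u" x] by simp
qed

text \<open>The Sherman--Morrison formula, read off from the equation \<open>(M - u u\<^sup>T) y = v\<close>.\<close>

lemma resolvent_downdate:
  assumes inv: "pos_def_inverse n M N" and u: "u \<in> carrier_vec n" and lt: "u \<bullet> (N *\<^sub>v u) < 1"
  shows "\<exists>N'. pos_def_inverse n (M - outer u) N' \<and>
    (\<forall>v\<in>carrier_vec n. v \<bullet> (N' *\<^sub>v v) = v \<bullet> (N *\<^sub>v v) + (v \<bullet> (N *\<^sub>v u))\<^sup>2 / (1 - u \<bullet> (N *\<^sub>v u)))"
proof -
  let ?M = "M - outer u"
  define w where "w = N *\<^sub>v u"
  define c where "c = u \<bullet> w"
  note carr = pos_def_inverse_carrier[OF inv]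
  have w: "w \<in> carrier_vec n" using carr u by (auto simp: w_def)
  have c1: "c < 1" using lt by (simp add: c_def w_def)
  have Mw: "M *\<^sub>v w = u" using pos_def_inverse_cancel[OF inv u] by (simp add: w_def)
  have quad: "x \<bullet> (?M *\<^sub>v x) = x \<bullet> (M *\<^sub>v x) - (u \<bullet> x)\<^sup>2" if x: "x \<in> carrier_vec n" for x
    using x u carr
    by (simp add: downdate_mult_vec scalar_prod_minus_distrib[of _ n] comm_scalar_prod[of x n u] power2_eq_square)
  have pd: "pos_def n ?M"
    unfolding pos_def_def
  proof (intro conjI ballI impI)
    show "?M \<in> carrier_mat n n" by (intro minus_carrier_mat outer_carrier u)
    show "?M\<^sup>T = ?M"
    proof -
      have "M $$ (j, i) = M $$ (i, j)" if "i < n" "j < n" for i j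
        using inv index_transpose_mat(1)[of i M j] carr that
        by (auto simp: pos_def_inverse_def pos_def_def)
      then show ?thesis using carr u by (intro eq_matI) (auto simp: outer_def)
    qed
    fix x :: "real vec" assume x: "x \<in> carrier_vec n" "x \<noteq> 0\<^sub>v n"
    define q where "q = x \<bullet> (M *\<^sub>v x)"
    define s where "s = u \<bullet> x"
    have q: "0 < q" using inv x by (auto simp: q_def pos_def_inverse_def pos_def_def)
    have xMw: "x \<bullet> u = s" using x u by (simp add: s_def comm_scalar_prod[of x n u])
    have wMx: "w \<bullet> (M *\<^sub>v x) = s"
      using pos_def_inverse_sym(2)[OF inv w x(1)] by (simp add: Mw xMw)
    have wu: "w \<bullet> u = c" using w u by (simp add: c_def comm_scalar_prod[of w n u])
    \<comment> \<open>A weak Cauchy--Schwarz inequality for the form of \<open>M\<close>. The best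
      multiple of \<open>w\<close> to subtract would be \<open>s / c\<close>; the multiple
      \<open>s\<close> avoids dividing by \<open>c\<close>, which is 0 when \<open>u\<close> is, and
      still gives \<open>s\<^sup>2 < q\<close> because \<open>c < 1\<close>.\<close>
    have "0 \<le> (x - s \<cdot>\<^sub>v w) \<bullet> (M *\<^sub>v (x - s \<cdot>\<^sub>v w))"
      using inv x w by (intro pos_def_nonneg[of n]) (auto simp: pos_def_inverse_def)
    also have "M *\<^sub>v (x - s \<cdot>\<^sub>v w) = M *\<^sub>v x - s \<cdot>\<^sub>v u"
      using carr x w by (simp add: mult_minus_distrib_mat_vec[of _ n n] mult_mat_vec[of _ n n] Mw)
    also have "(x - s \<cdot>\<^sub>v w) \<bullet> (M *\<^sub>v x - s \<cdot>\<^sub>v u) = q - s\<^sup>2 - s\<^sup>2 + s\<^sup>2 * c"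
      using x w u carr
      by (simp add: scalar_prod_minus_distrib[of _ n] minus_scalar_prod_distrib[of _ n] xMw wMx wu
          q_def[symmetric] power2_eq_square algebra_simps)
    finally have a: "(2 - c) * s\<^sup>2 \<le> q" by (simp add: algebra_simps)
    have "s\<^sup>2 < q"
    proof (cases "s = 0")
      case False
      have "1 * s\<^sup>2 < (2 - c) * s\<^sup>2" using c1 False by (intro mult_strict_right_mono) auto
      with a show ?thesis by simp
    qed (use q in auto)
    then show "0 < x \<bullet> (?M *\<^sub>v x)" using quad[OF x(1)] by (simp add: q_def s_def)
  qed
  then obtain N' where N': "pos_def_inverse n ?M N'" using pos_def_inverse_exists by blast
  note carr' = pos_def_inverse_carrier[OF N']
  have "v \<bullet> (N' *\<^sub>v v) = v \<bullet> (N *\<^sub>v v) + (v \<bullet> w)\<^sup>2 / (1 - c)" if v: "v \<in> carrier_vec n" for v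
  proof -
    define y where "y = N' *\<^sub>v v"
    have y: "y \<in> carrier_vec n" using carr' v by (auto simp: y_def)
    define s where "s = u \<bullet> y"
    have veq: "v = M *\<^sub>v y - s \<cdot>\<^sub>v u"
      using pos_def_inverse_cancel(1)[OF N' v] downdate_mult_vec[OF carr(1) y u]
      by (simp add: y_def s_def)
    have Nv: "N *\<^sub>v v = y - s \<cdot>\<^sub>v w"
      unfolding veq using carr y u
      by (simp add: mult_minus_distrib_mat_vec[of _ n n] mult_mat_vec[of _ n n] w_def
          pos_def_inverse_cancel[OF inv])
    \<comment> \<open>Pairing with \<open>u\<close> determines the unknown
      \<open>s = u \<bullet> y\<close> in terms of \<open>v \<bullet> w\<close>.\<close>
    have "v \<bullet> w = u \<bullet> (N *\<^sub>v v)" unfolding w_def by (rule pos_def_inverse_sym[OF inv v u])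
    also have "\<dots> = s - s * c"
      unfolding Nv using u y w by (simp add: scalar_prod_minus_distrib[of _ n] s_def c_def)
    finally have vw: "v \<bullet> w = s * (1 - c)" by (simp add: algebra_simps)
    have "v \<bullet> (N *\<^sub>v v) = v \<bullet> y - s * (v \<bullet> w)"
      unfolding Nv using v y w by (simp add: scalar_prod_minus_distrib[of _ n])
    then have "v \<bullet> y = v \<bullet> (N *\<^sub>v v) + s * (s * (1 - c))" unfolding vw by simp
    also have "s * (s * (1 - c)) = (v \<bullet> w)\<^sup>2 / (1 - c)"
      unfolding vw using c1 by (simp add: power2_eq_square)
    finally show ?thesis by (simp add: y_def)
  qed
  with N' show ?thesis unfolding c_def w_def by blast
qed

section \<open>The barrier argument\<close>

lemma scaled_identity_mult_vec:
  fixes x :: "real vec"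
  assumes "x \<in> carrier_vec n"
  shows "(b \<cdot>\<^sub>m 1\<^sub>m n) *\<^sub>v x = b \<cdot>\<^sub>v x"
  using assms by (intro eq_vecI) auto

lemma pos_def_inverse_scaled_identity:
  assumes "0 < b"
  shows "pos_def_inverse n (b \<cdot>\<^sub>m 1\<^sub>m n) ((1 / b) \<cdot>\<^sub>m 1\<^sub>m n)"
proof -
  have T: "(c \<cdot>\<^sub>m 1\<^sub>m n)\<^sup>T = c \<cdot>\<^sub>m (1\<^sub>m n :: real mat)" for c
    by (intro eq_matI) auto
  have "0 < x \<bullet> ((b \<cdot>\<^sub>m 1\<^sub>m n) *\<^sub>v x)" if x: "x \<in> carrier_vec n" "x \<noteq> 0\<^sub>v n" for x :: "real vec"
    using assms x scalar_prod_self_eq_0[OF x(1)] scalar_prod_self_nonneg[of x]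
    by (auto simp: scaled_identity_mult_vec less_le)
  moreover have "(b \<cdot>\<^sub>m 1\<^sub>m n) * ((1 / b) \<cdot>\<^sub>m 1\<^sub>m n) = (1\<^sub>m n :: real mat)"
    "((1 / b) \<cdot>\<^sub>m 1\<^sub>m n) * (b \<cdot>\<^sub>m 1\<^sub>m n) = (1\<^sub>m n :: real mat)"
    using assms by (auto intro!: eq_matI)
  ultimately show ?thesis by (simp add: pos_def_inverse_def pos_def_def T)
qed

lemma exists_less_one_of_sum_less_card:
  fixes f :: "'a \<Rightarrow> real"
  assumes "sum f A < card A"
  shows "\<exists>i\<in>A. f i < 1"
proof (rule ccontr)
  assume "\<not> ?thesis"
  then have "of_nat (card A) * 1 \<le> sum f A" by (intro sum_bounded_below) (auto simp: not_less)
  with assms show False by simp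
qed

context
  fixes n m :: nat and u :: "nat \<Rightarrow> real vec" and t \<delta> :: real
  assumes u: "\<And>i. i < m \<Longrightarrow> u i \<in> carrier_vec n"
    and frame: "\<And>w. w \<in> carrier_vec n \<Longrightarrow> (\<Sum>i<m. (u i \<bullet> w)\<^sup>2) \<le> t\<^sup>2 * (w \<bullet> w)"
    and \<delta>: "0 < \<delta>"
begin

text \<open>Here \<open>M\<close> is the gap between barrier and selected part, and \<open>t\<close>
  will be the operator norm of the matrix with columns \<open>u i\<close>. The same
  \<open>\<phi>\<close> bounds the potential before and after, which is what allows
  iteration.\<close>

lemma barrier_step:
  assumes inv: "pos_def_inverse n M N"
    and \<sigma>: "\<sigma> \<subseteq> {..<m}"
    and pot: "(\<Sum>i<m. u i \<bullet> (N *\<^sub>v u i)) \<le> \<phi>"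
    and budget: "\<phi> + t\<^sup>2 / \<delta> < real (m - card \<sigma>)"
  shows "\<exists>i\<in>{..<m} - \<sigma>. \<exists>N'. pos_def_inverse n (M + \<delta> \<cdot>\<^sub>m 1\<^sub>m n - outer (u i)) N' \<and>
    (\<Sum>i<m. u i \<bullet> (N' *\<^sub>v u i)) \<le> \<phi>"
proof -
  from resolvent_shift[OF inv, of \<delta>] \<delta> obtain R
    where R: "pos_def_inverse n (M + \<delta> \<cdot>\<^sub>m 1\<^sub>m n) R"
      and drop: "\<And>v. v \<in> carrier_vec n \<Longrightarrow>
        \<delta> * ((R *\<^sub>v v) \<bullet> (R *\<^sub>v v)) \<le> v \<bullet> (N *\<^sub>v v) - v \<bullet> (R *\<^sub>v v)"
    by (meson less_imp_le)
  define w where "w i = R *\<^sub>v u i" for i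
  have w: "w i \<in> carrier_vec n" if "i < m" for i
    using u[OF that] pos_def_inverse_carrier[OF R] by (auto simp: w_def)
  define W where "W = (\<Sum>i<m. w i \<bullet> w i)"
  define \<Phi> where "\<Phi> = (\<Sum>i<m. u i \<bullet> w i)"
  define q where "q i = (\<Sum>l<m. (u l \<bullet> w i)\<^sup>2)" for i
  have q0: "0 \<le> q i" for i by (auto simp: q_def intro: sum_nonneg)
  have c0: "0 \<le> u i \<bullet> w i" if "i < m" for i
    unfolding w_def by (rule pos_def_inverse_nonneg[OF R u[OF that]])
  have W0: "0 \<le> W" unfolding W_def by (intro sum_nonneg scalar_prod_self_nonneg)
  have "\<delta> * W \<le> (\<Sum>i<m. u i \<bullet> (N *\<^sub>v u i) - u i \<bullet> w i)"
    unfolding W_def sum_distrib_left w_def using u by (intro sum_mono drop) auto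
  \<comment> \<open>The drop \<open>\<delta> * W\<close> caused by the shift is the amount that the
    new column may cost.\<close>
  with pot have gain: "\<Phi> + \<delta> * W \<le> \<phi>" by (simp add: sum_subtractf \<Phi>_def)
  have qw: "q i \<le> t\<^sup>2 * (w i \<bullet> w i)" if "i < m" for i
    unfolding q_def by (rule frame[OF w[OF that]])
  have fin: "finite \<sigma>" using \<sigma> finite_subset by blast
  \<comment> \<open>For \<open>W > 0\<close>, \<open>f i < 1\<close> rearranges to
    \<open>q i / (1 - u i \<bullet> w i) < \<delta> * W\<close>: column \<open>i\<close> costs less
    than the shift has gained. It also forces \<open>u i \<bullet> w i < 1\<close>, as
    Sherman--Morrison requires.\<close>
  define f where "f i = q i / (\<delta> * W) + u i \<bullet> w i" for i
  have "sum f ({..<m} - \<sigma>) \<le> sum f {..<m}"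
    unfolding f_def using q0 c0 W0 \<delta> by (intro sum_mono2) (auto intro!: add_nonneg_nonneg)
  also have "\<dots> = sum q {..<m} / (\<delta> * W) + \<Phi>"
    by (simp add: f_def \<Phi>_def sum.distrib sum_divide_distrib)
  also have "sum q {..<m} / (\<delta> * W) \<le> t\<^sup>2 / \<delta>"
  proof -
    have "sum q {..<m} \<le> t\<^sup>2 * W"
      unfolding W_def sum_distrib_left using qw by (intro sum_mono) auto
    then have "sum q {..<m} / (\<delta> * W) \<le> t\<^sup>2 * W / (\<delta> * W)"
      using W0 \<delta> by (intro divide_right_mono) auto
    also have "\<dots> \<le> t\<^sup>2 / \<delta>" using \<delta> by (cases "W = 0") auto
    finally show ?thesis .
  qed
  also have "t\<^sup>2 / \<delta> + \<Phi> \<le> \<phi> + t\<^sup>2 / \<delta>"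
    using gain mult_nonneg_nonneg[of \<delta> W] \<delta> W0 by linarith
  also have "\<dots> < card ({..<m} - \<sigma>)" using budget \<sigma> fin by (simp add: card_Diff_subset)
  finally obtain i where i: "i < m" "i \<notin> \<sigma>" and fi: "f i < 1"
    using exists_less_one_of_sum_less_card[of f "{..<m} - \<sigma>"] by auto
  have "0 \<le> q i / (\<delta> * W)" using q0 W0 \<delta> by simp
  with fi have lt: "u i \<bullet> w i < 1" unfolding f_def by linarith
  \<comment> \<open>For \<open>W = 0\<close> the quotient in \<open>f i\<close> is 0 by convention
    and says nothing about \<open>q i\<close>; but then \<open>w i \<bullet> w i = 0\<close>, and
    the frame bound makes \<open>q i\<close> vanish.\<close>
  have incr: "q i / (1 - u i \<bullet> w i) \<le> \<delta> * W"
  proof (cases "W = 0")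
    case True
    then have "w i \<bullet> w i = 0"
      unfolding W_def using i(1) by (simp add: sum_nonneg_eq_0_iff scalar_prod_self_nonneg)
    then have "q i = 0" using qw[OF i(1)] q0[of i] by simp
    then show ?thesis using True by simp
  next
    case False
    then have pos: "0 < \<delta> * W" using W0 \<delta> by simp
    from fi have "q i / (\<delta> * W) < 1 - u i \<bullet> w i" unfolding f_def by linarith
    then have "q i < \<delta> * W * (1 - u i \<bullet> w i)"
      unfolding pos_divide_less_eq[OF pos] by (simp only: mult.commute)
    with lt show ?thesis by (simp add: pos_divide_le_eq)
  qed
  from resolvent_downdate[OF R u[OF i(1)]] lt obtain N'
    where N': "pos_def_inverse n (M + \<delta> \<cdot>\<^sub>m 1\<^sub>m n - outer (u i)) N'"
      and eq: "\<And>v. v \<in> carrier_vec n \<Longrightarrow>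
        v \<bullet> (N' *\<^sub>v v) = v \<bullet> (R *\<^sub>v v) + (v \<bullet> w i)\<^sup>2 / (1 - u i \<bullet> w i)"
    unfolding w_def by blast
  have "(\<Sum>l<m. u l \<bullet> (N' *\<^sub>v u l)) = \<Phi> + q i / (1 - u i \<bullet> w i)"
    using u by (simp add: eq \<Phi>_def q_def w_def sum.distrib sum_divide_distrib)
  also have "\<dots> \<le> \<phi>" using incr gain by linarith
  finally show ?thesis using N' i by blast
qed

text \<open>Induction on the number \<open>j\<close> of selected columns, with \<open>k\<close> and
  hence the budget fixed. The matrix \<open>M\<close> is recorded through its quadratic form, so
  that no sum of outer products has to be written; \<open>N\<close> is used only for the
  potential.\<close>

lemma barrier_iteration:
  assumes b: "0 < b"
    and k: "k \<le> m"
    and budget: "(\<Sum>i<m. u i \<bullet> u i) / b + t\<^sup>2 / \<delta> < real m - real k + 1"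
    and j: "j \<le> k"
  shows "\<exists>\<sigma>\<subseteq>{..<m}. card \<sigma> = j \<and> (\<exists>M N. pos_def_inverse n M N \<and>
    (\<Sum>i<m. u i \<bullet> (N *\<^sub>v u i)) \<le> (\<Sum>i<m. u i \<bullet> u i) / b \<and>
    (\<forall>x\<in>carrier_vec n. x \<bullet> (M *\<^sub>v x) = (b + j * \<delta>) * (x \<bullet> x) - (\<Sum>i\<in>\<sigma>. (u i \<bullet> x)\<^sup>2)))"
  using j
proof (induction j)
  case 0
  have "(\<Sum>i<m. u i \<bullet> (((1 / b) \<cdot>\<^sub>m 1\<^sub>m n) *\<^sub>v u i)) = (\<Sum>i<m. u i \<bullet> u i) / b"
    unfolding sum_divide_distrib using u
    by (intro sum.cong) (auto simp: scaled_identity_mult_vec scalar_prod_smult_distrib[of _ n])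
  then show ?case
    using pos_def_inverse_scaled_identity[OF b, of n]
    by (intro exI[of _ "{}"] conjI exI[of _ "b \<cdot>\<^sub>m 1\<^sub>m n"] exI[of _ "(1 / b) \<cdot>\<^sub>m 1\<^sub>m n"])
      (auto simp: scaled_identity_mult_vec)
next
  case (Suc j)
  then obtain \<sigma> M N where \<sigma>: "\<sigma> \<subseteq> {..<m}" "card \<sigma> = j" and inv: "pos_def_inverse n M N"
    and pot: "(\<Sum>i<m. u i \<bullet> (N *\<^sub>v u i)) \<le> (\<Sum>i<m. u i \<bullet> u i) / b"
    and quad: "\<And>x. x \<in> carrier_vec n \<Longrightarrow>
      x \<bullet> (M *\<^sub>v x) = (b + j * \<delta>) * (x \<bullet> x) - (\<Sum>i\<in>\<sigma>. (u i \<bullet> x)\<^sup>2)"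
    by (auto dest: Suc_leD)
  \<comment> \<open>Before each step at most \<open>k - 1\<close> columns have been taken, so at
    least \<open>m - k + 1\<close> remain. This extra 1 later absorbs the rounding of
    \<open>lam * m\<close> up to an integer.\<close>
  have "real m - real k + 1 \<le> real (m - card \<sigma>)" using Suc.prems k \<sigma>(2) by linarith
  with budget have "(\<Sum>i<m. u i \<bullet> u i) / b + t\<^sup>2 / \<delta> < real (m - card \<sigma>)" by linarith
  from barrier_step[OF inv \<sigma>(1) pot this] obtain i N' where i: "i < m" "i \<notin> \<sigma>"
    and N': "pos_def_inverse n (M + \<delta> \<cdot>\<^sub>m 1\<^sub>m n - outer (u i)) N'"
    and pot': "(\<Sum>i<m. u i \<bullet> (N' *\<^sub>v u i)) \<le> (\<Sum>i<m. u i \<bullet> u i) / b"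
    by auto
  have fin: "finite \<sigma>" using \<sigma> finite_subset by blast
  note M = pos_def_inverse_carrier(1)[OF inv] and ui = u[OF i(1)]
  have "x \<bullet> ((M + \<delta> \<cdot>\<^sub>m 1\<^sub>m n - outer (u i)) *\<^sub>v x) =
      (b + Suc j * \<delta>) * (x \<bullet> x) - (\<Sum>i\<in>insert i \<sigma>. (u i \<bullet> x)\<^sup>2)"
    if x: "x \<in> carrier_vec n" for x
  proof -
    have Mx: "M *\<^sub>v x \<in> carrier_vec n" using M x by auto
    have "(M + \<delta> \<cdot>\<^sub>m 1\<^sub>m n - outer (u i)) *\<^sub>v x = (M *\<^sub>v x + \<delta> \<cdot>\<^sub>v x) - (u i \<bullet> x) \<cdot>\<^sub>v u i"
      using downdate_mult_vec[of "M + \<delta> \<cdot>\<^sub>m 1\<^sub>m n" n x "u i"] M ui x by (simp add: shift_mult_vec)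
    then have "x \<bullet> ((M + \<delta> \<cdot>\<^sub>m 1\<^sub>m n - outer (u i)) *\<^sub>v x) =
        x \<bullet> (M *\<^sub>v x) + \<delta> * (x \<bullet> x) - (u i \<bullet> x)\<^sup>2"
      using x ui Mx
      by (simp add: scalar_prod_minus_distrib[of _ n] scalar_prod_add_distrib[of _ n]
          comm_scalar_prod[of x n "u i"] power2_eq_square)
    then show ?thesis using quad[OF x] fin i by (simp add: algebra_simps)
  qed
  moreover have "insert i \<sigma> \<subseteq> {..<m}" "card (insert i \<sigma>) = Suc j" using i \<sigma> fin by auto
  ultimately show ?case using N' pot' by blast
qed

text \<open>After \<open>k\<close> steps, positivity of the final \<open>M\<close> is exactly the
  assertion that the selected part lies below the barrier \<open>b + k * \<delta>\<close>.\<close>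

lemma subset_with_frame_bound:
  assumes "0 < b" "k \<le> m"
    and "(\<Sum>i<m. u i \<bullet> u i) / b + t\<^sup>2 / \<delta> < real m - real k + 1"
  shows "\<exists>\<sigma>\<subseteq>{..<m}. card \<sigma> = k \<and>
    (\<forall>x\<in>carrier_vec n. (\<Sum>i\<in>\<sigma>. (u i \<bullet> x)\<^sup>2) \<le> (b + k * \<delta>) * (x \<bullet> x))"
proof -
  from barrier_iteration[OF assms order.refl] obtain \<sigma> M N
    where \<sigma>: "\<sigma> \<subseteq> {..<m}" "card \<sigma> = k" and inv: "pos_def_inverse n M N"
      and quad: "\<And>x. x \<in> carrier_vec n \<Longrightarrow>
        x \<bullet> (M *\<^sub>v x) = (b + k * \<delta>) * (x \<bullet> x) - (\<Sum>i\<in>\<sigma>. (u i \<bullet> x)\<^sup>2)"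
    by auto
  have "(\<Sum>i\<in>\<sigma>. (u i \<bullet> x)\<^sup>2) \<le> (b + k * \<delta>) * (x \<bullet> x)" if "x \<in> carrier_vec n" for x
    using quad[OF that] pos_def_nonneg[of n M x] inv that by (simp add: pos_def_inverse_def)
  with \<sigma> show ?thesis by blast
qed

end

section \<open>Operator norms and sums over columns\<close>

lemma vec_norm2_sq: "(vec_norm2 v)\<^sup>2 = v \<bullet> v"
  by (simp add: vec_norm2_def scalar_prod_self_nonneg)

lemma vec_norm2_smult: "vec_norm2 (c \<cdot>\<^sub>v v) = \<bar>c\<bar> * vec_norm2 v"
proof -
  have "(c \<cdot>\<^sub>v v) \<bullet> (c \<cdot>\<^sub>v v) = c\<^sup>2 * (v \<bullet> v)"
    by (simp add: scalar_prod_def sum_distrib_left power2_eq_square mult_ac)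
  then show ?thesis by (simp add: vec_norm2_def real_sqrt_mult)
qed

lemma scalar_prod_cauchy_schwarz:
  fixes x y :: "real vec"
  assumes "x \<in> carrier_vec n" "y \<in> carrier_vec n"
  shows "x \<bullet> y \<le> vec_norm2 x * vec_norm2 y"
proof -
  have "x \<bullet> y \<le> (\<Sum>i\<in>{0..<n}. \<bar>x $ i\<bar> * \<bar>y $ i\<bar>)"
    using assms unfolding scalar_prod_def by (auto intro!: sum_mono simp flip: abs_mult)
  also have "\<dots> \<le> L2_set (($) x) {0..<n} * L2_set (($) y) {0..<n}"
    by (rule L2_set_mult_ineq)
  also have "\<dots> = vec_norm2 x * vec_norm2 y"
    using assms by (simp add: vec_norm2_def L2_set_def scalar_prod_def power2_eq_square)
  finally show ?thesis .
qed

lemma op_norm_nonneg: "0 \<le> op_norm A"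
proof -
  have "vec_norm2 (A *\<^sub>v 0\<^sub>v (dim_col A)) \<le> op_norm A"
    unfolding op_norm_def
    by (intro cSup_upper op_norm_bdd_above CollectI exI[of _ "0\<^sub>v (dim_col A)"]) (auto simp: vec_norm2_def)
  with vec_norm2_nonneg show ?thesis by (rule order_trans)
qed

lemma vec_norm2_mult_le_op_norm:
  assumes A: "A \<in> carrier_mat n m" and x: "x \<in> carrier_vec m"
  shows "vec_norm2 (A *\<^sub>v x) \<le> op_norm A * vec_norm2 x"
proof (cases "vec_norm2 x = 0")
  case True
  then have "x \<bullet> x = 0" using vec_norm2_sq[of x] by simp
  then have "x = 0\<^sub>v m" using x scalar_prod_self_eq_0 by blast
  then have "A *\<^sub>v x = 0\<^sub>v n" using A by auto
  then show ?thesis using True by (simp add: vec_norm2_def)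
next
  case False
  define r where "r = vec_norm2 x"
  have r: "0 < r" using False vec_norm2_nonneg[of x] by (simp add: r_def)
  have "vec_norm2 (A *\<^sub>v ((1 / r) \<cdot>\<^sub>v x)) \<le> op_norm A"
    unfolding op_norm_def
    using A x r by (intro cSup_upper op_norm_bdd_above CollectI exI[of _ "(1 / r) \<cdot>\<^sub>v x"])
      (auto simp: vec_norm2_smult simp flip: r_def)
  then show ?thesis
    using r A x by (simp add: mult_mat_vec[of _ n m] vec_norm2_smult field_simps flip: r_def)
qed

lemma op_norm_le:
  assumes "A \<in> carrier_mat n m" "0 \<le> r"
    and "\<And>x. x \<in> carrier_vec m \<Longrightarrow> vec_norm2 (A *\<^sub>v x) \<le> r * vec_norm2 x"
  shows "op_norm A \<le> r"
  unfolding op_norm_def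
proof (rule cSup_least[OF op_norm_nonempty])
  fix s assume "s \<in> {vec_norm2 (A *\<^sub>v x) |x. x \<in> carrier_vec (dim_col A) \<and> vec_norm2 x \<le> 1}"
  then obtain x where "x \<in> carrier_vec m" "vec_norm2 x \<le> 1" "s = vec_norm2 (A *\<^sub>v x)"
    using assms(1) by auto
  with assms(3)[of x] mult_left_mono[of "vec_norm2 x" 1 r] assms(2) show "s \<le> r" by simp
qed

text \<open>\<open>A *\<^sub>v x\<close> paired with itself is
  \<open>A\<^sup>T *\<^sub>v (A *\<^sub>v x)\<close> paired with \<open>x\<close>; apply
  Cauchy--Schwarz and cancel one factor \<open>vec_norm2 (A *\<^sub>v x)\<close>. Sums over columns
  are norms of a transpose times a vector, so this links them to \<open>op_norm\<close> in both
  directions.\<close>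

lemma vec_norm2_mult_le_of_transpose:
  assumes A: "A \<in> carrier_mat n m" and r: "0 \<le> r"
    and T: "\<And>y. y \<in> carrier_vec n \<Longrightarrow> vec_norm2 (A\<^sup>T *\<^sub>v y) \<le> r * vec_norm2 y"
    and x: "x \<in> carrier_vec m"
  shows "vec_norm2 (A *\<^sub>v x) \<le> r * vec_norm2 x"
proof -
  have Ax: "A *\<^sub>v x \<in> carrier_vec n" using A x by auto
  let ?a = "vec_norm2 (A *\<^sub>v x)"
  have "?a\<^sup>2 = (A\<^sup>T *\<^sub>v (A *\<^sub>v x)) \<bullet> x"
    unfolding vec_norm2_sq using transpose_vec_mult_scalar[OF A x Ax] by simp
  also have "\<dots> \<le> vec_norm2 (A\<^sup>T *\<^sub>v (A *\<^sub>v x)) * vec_norm2 x"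
    using A x Ax by (intro scalar_prod_cauchy_schwarz[of _ m]) auto
  also have "\<dots> \<le> r * ?a * vec_norm2 x"
    by (intro mult_right_mono T Ax vec_norm2_nonneg)
  finally have "?a * ?a \<le> ?a * (r * vec_norm2 x)" by (simp add: power2_eq_square mult_ac)
  moreover have "0 \<le> r * vec_norm2 x" using r vec_norm2_nonneg by (rule mult_nonneg_nonneg)
  ultimately show ?thesis
    using vec_norm2_nonneg[of "A *\<^sub>v x"] mult_left_le_imp_le[of ?a ?a "r * vec_norm2 x"]
    by (cases "?a = 0") (simp, linarith)
qed

lemma transpose_mult_vec_scalar_prod_self:
  fixes A :: "real mat"
  assumes "A \<in> carrier_mat n m"
  shows "(A\<^sup>T *\<^sub>v w) \<bullet> (A\<^sup>T *\<^sub>v w) = (\<Sum>i<m. (col A i \<bullet> w)\<^sup>2)"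
  using assms by (simp add: scalar_prod_def[of "A\<^sup>T *\<^sub>v w"] power2_eq_square atLeast0LessThan)

text \<open>The sum is the squared norm of \<open>A\<^sup>T *\<^sub>v w\<close>. This supplies the
  frame hypothesis of the barrier argument with \<open>t = op_norm A\<close>.\<close>

lemma sum_col_scalar_prod_le_op_norm:
  assumes A: "A \<in> carrier_mat n m" and w: "w \<in> carrier_vec n"
  shows "(\<Sum>i<m. (col A i \<bullet> w)\<^sup>2) \<le> (op_norm A)\<^sup>2 * (w \<bullet> w)"
proof -
  have "vec_norm2 (A\<^sup>T *\<^sub>v w) \<le> op_norm A * vec_norm2 w"
  proof (rule vec_norm2_mult_le_of_transpose[OF _ op_norm_nonneg _ w])
    show "A\<^sup>T \<in> carrier_mat m n" using A by simp
    fix y :: "real vec" assume "y \<in> carrier_vec m"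
    then show "vec_norm2 (A\<^sup>T\<^sup>T *\<^sub>v y) \<le> op_norm A * vec_norm2 y"
      using vec_norm2_mult_le_op_norm[OF A] by simp
  qed
  from power_mono[OF this vec_norm2_nonneg, of 2] show ?thesis
    using transpose_mult_vec_scalar_prod_self[OF A, of w] by (simp add: power_mult_distrib vec_norm2_sq)
qed

text \<open>\<open>pick S\<close> is strictly increasing below \<open>card S\<close>, hence
  injective, and counting makes it onto. It translates column positions in the submatrix into
  indices in \<open>S\<close>.\<close>

lemma bij_betw_pick:
  assumes "finite S"
  shows "bij_betw (pick S) {..<card S} S"
proof -
  have "inj_on (pick S) {..<card S}"
  proof (rule linorder_inj_onI)
    fix i j assume "i < j" "i \<in> {..<card S}" "j \<in> {..<card S}"
    then show "pick S i \<noteq> pick S j" using pick_mono_le[of j S i] by simp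
  qed auto
  moreover have "pick S ` {..<card S} \<subseteq> S" by (auto simp: pick_in_set_le)
  ultimately show ?thesis
    using card_subset_eq[OF assms, of "pick S ` {..<card S}"] by (simp add: bij_betw_def card_image)
qed

text \<open>The entries of \<open>?B\<^sup>T *\<^sub>v y\<close> are the products of
  \<open>y\<close> with the selected columns, so the hypothesis bounds the transpose, and the bound
  passes to \<open>?B\<close>.\<close>

lemma op_norm_select_cols_le:
  assumes A: "A \<in> carrier_mat n m" and S: "S \<subseteq> {..<m}" and b: "0 \<le> b"
    and le: "\<And>x. x \<in> carrier_vec n \<Longrightarrow> (\<Sum>i\<in>S. (col A i \<bullet> x)\<^sup>2) \<le> b * (x \<bullet> x)"
  shows "op_norm (select_cols A S) \<le> sqrt b"
proof -
  let ?B = "select_cols A S"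
  have B: "?B \<in> carrier_mat n (card S)" by (rule select_cols_carrier[OF A S])
  have fin: "finite S" using S finite_subset by blast
  have eqS: "{j. j < m \<and> j \<in> S} = S" using S by auto
  have colB: "col ?B j = col A (pick S j)" if "j < card S" for j
  proof -
    have "pick S j < m" using pick_in_set_le[OF that] S by auto
    then show ?thesis using that A B
      by (intro eq_vecI) (auto simp: select_cols_def submatrix_def eqS pick_UNIV)
  qed
  have "vec_norm2 (?B\<^sup>T *\<^sub>v y) \<le> sqrt b * vec_norm2 y" if y: "y \<in> carrier_vec n" for y
  proof -
    have "(\<Sum>j<card S. (col ?B j \<bullet> y)\<^sup>2) = (\<Sum>j<card S. (col A (pick S j) \<bullet> y)\<^sup>2)"
      by (simp add: colB)
    also have "\<dots> = (\<Sum>i\<in>S. (col A i \<bullet> y)\<^sup>2)"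
      by (rule sum.reindex_bij_betw[OF bij_betw_pick[OF fin]])
    finally have "(?B\<^sup>T *\<^sub>v y) \<bullet> (?B\<^sup>T *\<^sub>v y) \<le> b * (y \<bullet> y)"
      using le[OF y] transpose_mult_vec_scalar_prod_self[OF B, of y] by simp
    then show ?thesis by (simp add: vec_norm2_def flip: real_sqrt_mult)
  qed
  with b show ?thesis
    by (intro op_norm_le[OF B] vec_norm2_mult_le_of_transpose[OF B]) auto
qed

section \<open>The Hilbert-Schmidt norm and the choice of barrier parameters\<close>

lemma hs_norm_nonneg: "0 \<le> hs_norm A"
  by (simp add: hs_norm_def mat_trace_def sum_nonneg scalar_prod_self_nonneg)

text \<open>Both sides add up the squared entries, by rows and by columns. Hence the initial
  potential at barrier \<open>b\<close> is the squared Hilbert-Schmidt norm divided by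
  \<open>b\<close>.\<close>

lemma hs_norm_sq:
  assumes "A \<in> carrier_mat n m"
  shows "(hs_norm A)\<^sup>2 = (\<Sum>i<m. col A i \<bullet> col A i)"
proof -
  have "mat_trace (A * A\<^sup>T) = (\<Sum>i<n. \<Sum>j<m. A $$ (i, j) * A $$ (i, j))"
    using assms by (simp add: mat_trace_def scalar_prod_def atLeast0LessThan)
  also have "\<dots> = (\<Sum>j<m. \<Sum>i<n. A $$ (i, j) * A $$ (i, j))" by (rule sum.swap)
  also have "\<dots> = (\<Sum>i<m. col A i \<bullet> col A i)"
    using assms by (simp add: scalar_prod_def atLeast0LessThan)
  finally show ?thesis by (simp add: hs_norm_def sum_nonneg scalar_prod_self_nonneg)
qed

text \<open>By Cauchy--Schwarz,
  \<open>(b + k * \<delta>) * (h\<^sup>2 / b + t\<^sup>2 / \<delta>)\<close> is at least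
  \<open>(h + sqrt k * t)\<^sup>2\<close>. The barrier method is run at the equality case, with the
  second factor equal to the budget \<open>c\<close>.\<close>

lemma column_selection:
  fixes U :: "real mat"
  assumes U: "U \<in> carrier_mat n m" and k: "1 \<le> k" "k \<le> m"
    and c: "0 < c" "c < real m - real k + 1"
  shows "\<exists>\<sigma>\<subseteq>{..<m}. card \<sigma> = k \<and>
    op_norm (select_cols U \<sigma>) \<le> (hs_norm U + sqrt k * op_norm U) / sqrt c"
proof -
  define h where "h = hs_norm U"
  define t where "t = op_norm U"
  have t0: "0 \<le> t" unfolding t_def by (rule op_norm_nonneg)
  have h0: "0 \<le> h" unfolding h_def by (rule hs_norm_nonneg)
  have hsq: "(\<Sum>i<m. col U i \<bullet> col U i) = h\<^sup>2" unfolding h_def hs_norm_sq[OF U] ..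
  have frame: "(\<Sum>i<m. (col U i \<bullet> w)\<^sup>2) \<le> t\<^sup>2 * (w \<bullet> w)" if "w \<in> carrier_vec n" for w
    unfolding t_def by (rule sum_col_scalar_prod_le_op_norm[OF U that])
  have colU: "col U i \<in> carrier_vec n" for i using U by auto
  show ?thesis
  \<comment> \<open>If either norm vanishes, the optimal \<open>b\<close> or \<open>\<delta>\<close>
    would be 0, which the barrier method does not admit. All columns then contribute 0, and the
    first \<open>k\<close> of them serve.\<close>
  proof (cases "h = 0 \<or> t = 0")
    case True
    have "(\<Sum>i<m. (col U i \<bullet> x)\<^sup>2) \<le> 0" if x: "x \<in> carrier_vec n" for x
    proof (cases "t = 0")
      case True
      then show ?thesis using frame[OF x] by simp
    next
      case False
      with True have "(\<Sum>i<m. col U i \<bullet> col U i) = 0" using hsq by simp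
      then have "\<forall>i\<in>{..<m}. col U i \<bullet> col U i = 0"
        by (subst (asm) sum_nonneg_eq_0_iff) (simp_all only: scalar_prod_self_nonneg finite_lessThan)
      then have "col U i = 0\<^sub>v n" if "i < m" for i
        using that scalar_prod_self_eq_0[OF colU] by blast
      then show ?thesis using x by simp
    qed
    moreover have "(\<Sum>i<k. (col U i \<bullet> x)\<^sup>2) \<le> (\<Sum>i<m. (col U i \<bullet> x)\<^sup>2)" for x
      using k by (intro sum_mono2) auto
    ultimately have "op_norm (select_cols U {..<k}) \<le> sqrt 0"
      using k by (intro op_norm_select_cols_le[OF U]) (auto intro: order_trans)
    also have "\<dots> \<le> (h + sqrt k * t) / sqrt c" using h0 t0 c by simp
    finally show ?thesis using k unfolding h_def t_def by (intro exI[of _ "{..<k}"]) auto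
  next
    case False
    then have h: "0 < h" and t: "0 < t" using h0 t0 by auto
    define s where "s = h + sqrt k * t"
    \<comment> \<open>The minimizers of \<open>b + k \<delta>\<close> under the budget \<open>h\<^sup>2 / b + t\<^sup>2 / \<delta> = c\<close>.\<close>
    define b where "b = h * s / c"
    define \<delta> where "\<delta> = t * s / (sqrt k * c)"
    have s: "0 < s" using h t k by (simp add: s_def add_pos_nonneg)
    have b: "0 < b" and \<delta>: "0 < \<delta>" using h t k c s by (auto simp: b_def \<delta>_def)
    have "h\<^sup>2 / b + t\<^sup>2 / \<delta> = c * h / s + c * (sqrt k * t) / s"
    proof -
      have "h * h / (h * s / c) = c * h / s" "t * t / (t * s / (sqrt k * c)) = c * (sqrt k * t) / s"
        using h t c s k by (simp_all add: divide_simps)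
      then show ?thesis by (simp add: b_def \<delta>_def power2_eq_square)
    qed
    also have "\<dots> = c * s / s" by (simp only: s_def distrib_left add_divide_distrib)
    also have "\<dots> = c" using s by simp
    finally have budget: "(\<Sum>i<m. col U i \<bullet> col U i) / b + t\<^sup>2 / \<delta> < real m - real k + 1"
      using c hsq by simp
    from subset_with_frame_bound[of m "col U", OF colU frame \<delta> b k(2) budget]
    obtain \<sigma> where \<sigma>: "\<sigma> \<subseteq> {..<m}" "card \<sigma> = k"
      and bound: "\<forall>x\<in>carrier_vec n. (\<Sum>i\<in>\<sigma>. (col U i \<bullet> x)\<^sup>2) \<le> (b + k * \<delta>) * (x \<bullet> x)"
      by blast
    have "real k * \<delta> = sqrt k * t * s / c"
    proof -
      have "real k / sqrt k = sqrt k" by (rule real_div_sqrt) simp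
      then have "sqrt k * (t * s) / c = real k / sqrt k * (t * s) / c" by simp
      also have "\<dots> = real k * \<delta>" by (simp add: \<delta>_def)
      finally show ?thesis by (simp add: mult.assoc)
    qed
    then have eq: "b + k * \<delta> = s\<^sup>2 / c"
      by (simp only: b_def s_def power2_eq_square add_divide_distrib distrib_right)
    have "op_norm (select_cols U \<sigma>) \<le> sqrt (b + k * \<delta>)"
      using bound b \<delta> by (intro op_norm_select_cols_le[OF U \<sigma>(1)]) auto
    also have "\<dots> = s / sqrt c" unfolding eq using s by (simp add: real_sqrt_divide)
    finally show ?thesis using \<sigma> unfolding s_def h_def t_def by blast
  qed
qed

theorem theorem4p1:
  fixes U :: "real mat" and n m :: nat
  assumes "U \<in> carrier_mat n m" and "1 \<le> n" and "1 \<le> m"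
  shows "(\<forall>lam \<eta> :: real. 1 / real m \<le> lam \<and> lam \<le> \<eta> \<and> \<eta> < 1 \<longrightarrow>
           (\<exists>\<sigma> \<subseteq> {..<m}. real (card \<sigma>) \<ge> lam * real m \<and>
              op_norm (select_cols U \<sigma>) \<le>
                1 / sqrt (1 - lam) *
                (sqrt (lam + \<eta>) * op_norm U + sqrt (1 + lam / \<eta>) * (hs_norm U / sqrt (real m)))))
       \<and> (\<forall>lam :: real. 1 / real m \<le> lam \<and> lam < 1 \<longrightarrow>
           (\<exists>\<sigma> \<subseteq> {..<m}. real (card \<sigma>) \<ge> lam * real m \<and>
              op_norm (select_cols U \<sigma>) \<le>
                sqrt 2 / sqrt (1 - lam) *
                (sqrt lam * op_norm U + hs_norm U / sqrt (real m))))"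
proof -
  have main: "\<exists>\<sigma> \<subseteq> {..<m}. real (card \<sigma>) \<ge> lam * real m \<and>
      op_norm (select_cols U \<sigma>) \<le> 1 / sqrt (1 - lam) *
        (sqrt (lam + \<eta>) * op_norm U + sqrt (1 + lam / \<eta>) * (hs_norm U / sqrt (real m)))"
    if lam: "1 / real m \<le> lam" and le: "lam \<le> \<eta>" and \<eta>: "\<eta> < 1" for lam \<eta> :: real
  proof -
    have m: "0 < real m" using assms(3) by simp
    have lm: "1 \<le> lam * real m" using lam m by (simp add: field_simps)
    have lam0: "0 < lam" using lam m by (smt (verit) divide_pos_pos)
    have lam1: "lam < 1" using le \<eta> by simp
    \<comment> \<open>Since \<open>lam * m\<close> is at least 1, the ceiling is positive and
      \<open>nat\<close> loses nothing.\<close>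
    define k where "k = nat \<lceil>lam * real m\<rceil>"
    have k_ge: "lam * real m \<le> real k" and k_less: "real k < lam * real m + 1"
      unfolding k_def using lm by linarith+
    have k1: "1 \<le> k" using k_ge lm by linarith
    have "lam * real m < real m" using lam1 m by simp
    then have km: "k \<le> m" using k_less by linarith
    \<comment> \<open>The strict bound \<open>k < lam * m + 1\<close> leaves room for the budget
      \<open>c = (1 - lam) * m\<close>.\<close>
    have c: "0 < (1 - lam) * real m" "(1 - lam) * real m < real m - real k + 1"
      using lam1 m k_less by (auto simp: algebra_simps)
    from column_selection[OF assms(1) k1 km c] obtain \<sigma> where \<sigma>: "\<sigma> \<subseteq> {..<m}" "card \<sigma> = k"
      and bound: "op_norm (select_cols U \<sigma>) \<le> (hs_norm U + sqrt k * op_norm U) / sqrt ((1 - lam) * real m)"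
      by blast
    have h0: "0 \<le> hs_norm U" by (rule hs_norm_nonneg)
    have "lam * real m \<le> \<eta> * real m" using le m by simp
    \<comment> \<open>The 1 lost to rounding is at most \<open>lam * m\<close>, hence at most
      \<open>\<eta> * m\<close>.\<close>
    then have "real k \<le> (lam + \<eta>) * real m" using k_less lm by (simp add: algebra_simps)
    then have "sqrt k \<le> sqrt (lam + \<eta>) * sqrt m" by (simp flip: real_sqrt_mult)
    then have "sqrt k * op_norm U \<le> sqrt (lam + \<eta>) * sqrt m * op_norm U"
      by (intro mult_right_mono op_norm_nonneg)
    \<comment> \<open>The selection bound has coefficient 1 here; the factor in the claim only
      enlarges it.\<close>
    moreover have "1 * hs_norm U \<le> sqrt (1 + lam / \<eta>) * hs_norm U"
      using h0 lam0 le by (intro mult_right_mono) auto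
    ultimately have "hs_norm U + sqrt k * op_norm U \<le>
        sqrt m * (sqrt (lam + \<eta>) * op_norm U + sqrt (1 + lam / \<eta>) * (hs_norm U / sqrt m))"
      (is "_ \<le> sqrt m * ?R") using m by (simp add: distrib_left mult.assoc mult.left_commute[of "sqrt m"])
    then have "(hs_norm U + sqrt k * op_norm U) / sqrt ((1 - lam) * real m) \<le>
        sqrt m * ?R / sqrt ((1 - lam) * real m)"
      using c by (intro divide_right_mono) auto
    also have "\<dots> = 1 / sqrt (1 - lam) * ?R" using m by (simp add: real_sqrt_mult)
    finally show ?thesis using \<sigma> bound k_ge by (intro exI[of _ \<sigma>]) auto
  qed
  \<comment> \<open>The second claim is the case \<open>\<eta> = lam\<close>, where both square
    roots contain the factor \<open>sqrt 2\<close>.\<close>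
  have diag: "1 / sqrt (1 - lam) * (sqrt (lam + lam) * op_norm U + sqrt (1 + lam / lam) * (hs_norm U / sqrt m)) =
      sqrt 2 / sqrt (1 - lam) * (sqrt lam * op_norm U + hs_norm U / sqrt m)"
    if "1 / real m \<le> lam" for lam :: real
  proof -
    have "lam \<noteq> 0" using that assms(3) by (auto simp: field_simps)
    then have "sqrt (1 + lam / lam) = sqrt 2" by simp
    moreover have "sqrt (lam + lam) = sqrt 2 * sqrt lam" by (simp flip: real_sqrt_mult)
    ultimately show ?thesis by (simp add: distrib_left mult_ac add_divide_distrib)
  qed
  show ?thesis
  proof (intro conjI allI impI)
    fix lam :: real assume *: "1 / real m \<le> lam \<and> lam < 1"
    show "\<exists>\<sigma> \<subseteq> {..<m}. real (card \<sigma>) \<ge> lam * real m \<and>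
        op_norm (select_cols U \<sigma>) \<le>
          sqrt 2 / sqrt (1 - lam) * (sqrt lam * op_norm U + hs_norm U / sqrt (real m))"
      using main[of lam lam, unfolded diag[OF conjunct1[OF *]]] * by blast
  qed (use main in blast)
qed

end
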